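(* Let $n,r\in\mathbb{N}$, let $q_1,\ldots,q_n\in(0,1)$, and let $X_1,\ldots,X_n$ be independent with $X_j\sim\mathrm{Geo}(q_j)$. Put $X_{n:n}=\max(X_1,\ldots,X_n)$. Then $$\mathbb{E}[X_{n:n}^r]=\sum_{s=1}^{n}(-1)^{s+1}\sum_{A\subseteq\{1,\ldots,n\},\,|A|=s}\frac{1}{q_A}\sum_{l=1}^{r}{r \brace l}\Bigl(\frac{1}{q_A}-1\Bigr)^{l-1} l!,$$ where $q_A = 1-\prod_{j\in A}(1-q_j)$ and ${r\brace l}$ is the Stirling number of the second kind.
   Context: $\mathbb{N}=\{1,2,\ldots\}$. $\mathrm{Geo}(q)$ is the geometric distribution on $\{1,2,\ldots\}$ with $\mathbb{P}(X=k)=(1-q)^{k-1}q$. The Stirling number of the second kind ${r\brace l}$ is the number of partitions of an $r$-element set into $l$ nonempty blocks. *)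

theory Defs
  imports "HOL-Probability.Probability" "HOL-Combinatorics.Stirling"
begin

(* The library's geometric_pmf lives on {0,1,2,...}; Geo(q) here lives on {1,2,...}. *)
definition geo_pmf :: "real \<Rightarrow> nat pmf" where
  "geo_pmf q = map_pmf Suc (geometric_pmf q)"

lemma pmf_geo_pmf:
  assumes "0 < q" "q < 1" "1 \<le> k"
  shows "pmf (geo_pmf q) k = (1 - q) ^ (k - 1) * q"
proof -
  obtain m where "k = Suc m" using assms(3) by (cases k) auto
  then show ?thesis
    using assms by (simp add: geo_pmf_def pmf_map_inj' pmf_geometric)
qed

lemma pmf_geo_pmf_0: "pmf (geo_pmf q) 0 = 0"
  unfolding geo_pmf_def by (rule pmf_map_outside) auto

definition qset :: "(nat \<Rightarrow> real) \<Rightarrow> nat set \<Rightarrow> real" where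
  "qset q A = 1 - (\<Prod>j\<in>A. 1 - q j)"

end

theory Submission imports Defs begin

text \<open>
  By independence the distribution function of the maximum is
  \<open>\<Prod>j. 1 - (1 - q\<^sub>j) ^ k\<close>. Expanding the product over subsets and taking differences writes the
  mass function of the maximum as the signed sum, over nonempty sets \<open>A\<close>, of the mass functions of
  \<open>Geo(q\<^sub>A)\<close>. The moments of \<open>Geo(q)\<close> follow by writing \<open>k ^ r\<close> in terms of binomial coefficients,
  whose generating functions are negative binomial series.
\<close>

text \<open>Induction on \<open>r\<close>. Multiplying the falling factorial
  \<open>fact l * (x choose l)\<close> by \<open>x\<close> gives \<open>l\<close> times itself plus
  the next falling factorial; collecting coefficients yields exactly the recurrence of the Stirling
  numbers.\<close>

lemma power_eq_sum_Stirling_choose: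
  "real x ^ r = (\<Sum>l\<le>r. real (Stirling r l) * fact l * real (x choose l))"
proof (induction r)
  case (Suc r)
  have step: "fact l * real (x choose l) * real x =
      real l * (fact l * real (x choose l)) + fact (Suc l) * real (x choose Suc l)" for l
  proof -
    \<comment> \<open>The absorption identity, with \<open>Suc x choose Suc l\<close> expanded by
      Pascal's rule.\<close>
    have "Suc l * (x choose Suc l) + l * (x choose l) = x * (x choose l)"
      using Suc_times_binomial[of l x] by (simp add: algebra_simps)
    then have "real (Suc l) * real (x choose Suc l) + real l * real (x choose l)
        = real x * real (x choose l)"
      by (simp only: flip: of_nat_mult of_nat_add)
    from arg_cong[OF this, of "\<lambda>t. fact l * t"] show ?thesis
      by (simp add: algebra_simps)
  qed
  let ?b = "\<lambda>l. fact l * real (x choose l)"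
  have "real x ^ Suc r = (\<Sum>l\<le>r. real (Stirling r l) * (?b l * real x))"
    by (simp add: Suc sum_distrib_left mult_ac)
  also have "\<dots> = (\<Sum>l\<le>r. real (l * Stirling r l) * ?b l)
      + (\<Sum>l\<le>r. real (Stirling r l) * ?b (Suc l))"
    unfolding step by (simp add: algebra_simps sum.distrib del: fact_Suc)
  \<comment> \<open>The added term vanishes because \<open>Stirling r (Suc r) = 0\<close>. The term
    at \<open>l = 0\<close> vanishes by its factor \<open>l\<close>, so the next shift aligns both
    sums.\<close>
  also have "(\<Sum>l\<le>r. real (l * Stirling r l) * ?b l)
      = (\<Sum>l\<le>Suc r. real (l * Stirling r l) * ?b l)"
    by simp
  also have "\<dots> = (\<Sum>l\<le>r. real (Suc l * Stirling r (Suc l)) * ?b (Suc l))"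
    by (subst sum.atMost_Suc_shift) (simp del: fact_Suc)
  also have "\<dots> + (\<Sum>l\<le>r. real (Stirling r l) * ?b (Suc l))
      = (\<Sum>l\<le>r. real (Stirling (Suc r) (Suc l)) * ?b (Suc l))"
    by (simp add: algebra_simps sum.distrib del: fact_Suc)
  also have "\<dots> = (\<Sum>l\<le>Suc r. real (Stirling (Suc r) l) * ?b l)"
    by (subst sum.atMost_Suc_shift) (simp del: fact_Suc)
  finally show ?case
    by (simp only: mult.assoc)
qed simp

lemma pmf_nat_sums_1: "pmf p sums 1" for p :: "nat pmf"
proof -
  have "integrable (count_space UNIV) (pmf p)"
    by (rule integrable_pmf)
  moreover have "integral\<^sup>L (count_space UNIV) (pmf p) = 1"
    using integral_pmf[where M = p and X = UNIV] by simp
  ultimately show ?thesis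
    using sums_integral_count_space_nat[of "pmf p"] by simp
qed

text \<open>This is the binomial moment of order \<open>Suc m\<close> of Geo(q), the index
  \<open>k\<close> standing for the value \<open>Suc k\<close>. From \<open>k = m\<close> on, the
  terms are the constant \<open>p ^ m / q ^ Suc m\<close> times the negative binomial masses with
  parameter \<open>m + 2\<close>, whose total is 1.\<close>

lemma binomial_geometric_sums:
  fixes q :: real
  assumes "0 < q" "q < 1"
  shows "(\<lambda>k. real (Suc k choose Suc m) * ((1 - q) ^ k * q)) sums (1 / q * (1 / q - 1) ^ m)"
proof -
  define p where "p = 1 - q"
  have "(\<lambda>k. real ((k + Suc m) choose k) * q ^ (m + 2) * p ^ k) sums 1"
    using pmf_nat_sums_1[of "neg_binomial_pmf (m + 2) q"] assms
    by (subst (asm) sums_cong[OF pmf_neg_binomial]) (auto simp: p_def)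
  then have "(\<lambda>k. p ^ m / q ^ Suc m * (real ((k + Suc m) choose k) * q ^ (m + 2) * p ^ k))
      sums (p ^ m / q ^ Suc m * 1)"
    by (rule sums_mult)
  also have "(\<lambda>k. p ^ m / q ^ Suc m * (real ((k + Suc m) choose k) * q ^ (m + 2) * p ^ k))
      = (\<lambda>k. real (Suc (k + m) choose Suc m) * (p ^ (k + m) * q))"
    using assms binomial_symmetric[of k "Suc (k + m)" for k]
    by (auto simp: power_add field_simps simp del: binomial_Suc_Suc)
  also have "p ^ m / q ^ Suc m * 1 = 1 / q * (1 / q - 1) ^ m"
  proof -
    have "1 / q - 1 = p / q"
      using assms by (simp add: p_def field_simps)
    then show ?thesis
      by (simp add: power_divide)
  qed
  finally have *: "(\<lambda>k. real (Suc (k + m) choose Suc m) * (p ^ (k + m) * q))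
      sums (1 / q * (1 / q - 1) ^ m)" .
  \<comment> \<open>Undo the shift by \<open>m\<close>: the restored terms have
    \<open>Suc k < Suc m\<close>, so their binomial coefficients are 0.\<close>
  have "(\<lambda>k. real (Suc k choose Suc m) * (p ^ k * q)) sums
      (1 / q * (1 / q - 1) ^ m + (\<Sum>k<m. real (Suc k choose Suc m) * (p ^ k * q)))"
    using * by (subst (asm) sums_iff_shift)
  also have "(\<Sum>k<m. real (Suc k choose Suc m) * (p ^ k * q)) = 0"
    by (rule sum.neutral) (auto simp: binomial_eq_0)
  finally show ?thesis
    by (simp add: p_def)
qed

lemma geometric_moment_sums:
  fixes q :: real
  assumes "0 < q" "q < 1" "1 \<le> r"
  shows "(\<lambda>k. real (Suc k) ^ r * ((1 - q) ^ k * q)) sums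
    (1 / q * (\<Sum>l=1..r. real (Stirling r l) * (1 / q - 1) ^ (l - 1) * fact l))"
proof -
  \<comment> \<open>Since \<open>r\<close> is positive, the term \<open>l = 0\<close> drops out, so
    \<open>l - 1\<close> below is never truncated.\<close>
  have "{..r} = insert 0 {1..r}" by auto
  moreover have "Stirling r 0 = 0"
    using assms by (cases r) auto
  ultimately have pow: "real x ^ r = (\<Sum>l=1..r. real (Stirling r l) * fact l * real (x choose l))" for x
    by (simp add: power_eq_sum_Stirling_choose)
  have "(\<lambda>k. \<Sum>l=1..r. real (Stirling r l) * fact l * (real (Suc k choose l) * ((1 - q) ^ k * q)))
    sums (\<Sum>l=1..r. real (Stirling r l) * fact l * (1 / q * (1 / q - 1) ^ (l - 1)))"
  proof (intro sums_sum sums_mult)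
    fix l assume "l \<in> {1..r}"
    then obtain m where "l = Suc m"
      by (cases l) auto
    then show "(\<lambda>k. real (Suc k choose l) * ((1 - q) ^ k * q)) sums (1 / q * (1 / q - 1) ^ (l - 1))"
      using binomial_geometric_sums[OF assms(1,2), of m] by simp
  qed
  then show ?thesis
    by (simp only: pow sum_distrib_left sum_distrib_right mult_ac)
qed

text \<open>The law of \<open>Y\<close> has density \<open>g\<close> with respect to counting
  measure, so the expectation becomes a series. As \<open>f\<close> is nonnegative, convergence is
  absolute and gives integrability along with the value.\<close>

lemma (in prob_space) has_bochner_integral_nat_valued:
  fixes Y :: "'a \<Rightarrow> nat" and f :: "nat \<Rightarrow> real"
  assumes Y [measurable]: "Y \<in> measurable M (count_space UNIV)"
    and f: "\<And>k. 0 \<le> f k"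
    and sums: "(\<lambda>k. f k * prob (Y -` {k} \<inter> space M)) sums S"
  shows "has_bochner_integral M (\<lambda>\<omega>. f (Y \<omega>)) S"
proof -
  define g where "g k = prob (Y -` {k} \<inter> space M)" for k
  have D: "distr M (count_space UNIV) Y = density (count_space UNIV) (\<lambda>k. ennreal (g k))"
    by (rule measure_eqI_countable[where A = UNIV])
      (auto simp: emeasure_distr emeasure_density emeasure_eq_measure g_def
        mult.commute[of "indicator _ _"])
  have int: "integrable (count_space UNIV) (\<lambda>k. g k * f k)"
    using sums f by (auto simp: integrable_count_space_nat_iff g_def abs_mult sums_iff mult.commute)
  have "integral\<^sup>L (count_space UNIV) (\<lambda>k. g k * f k) = S"
    using sums integral_count_space_nat[OF int] by (simp add: g_def sums_iff mult.commute)
  with int have "has_bochner_integral (distr M (count_space UNIV) Y) f S"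
    unfolding D has_bochner_integral_iff
    by (simp add: integrable_density integral_density g_def)
  then show ?thesis
    by (simp add: has_bochner_integral_iff integrable_distr_eq integral_distr)
qed

lemma geo_pmf_atMost:
  assumes "0 < q" "q < 1"
  shows "measure_pmf.prob (geo_pmf q) {..k} = 1 - (1 - q) ^ k"
proof -
  have "measure_pmf.prob (geo_pmf q) {..k} = (\<Sum>i\<le>k. pmf (geo_pmf q) i)"
    by (rule measure_measure_pmf_finite) simp
  also have "\<dots> = 1 - (1 - q) ^ k"
    by (induction k) (use assms in \<open>auto simp: pmf_geo_pmf pmf_geo_pmf_0 algebra_simps\<close>)
  finally show ?thesis .
qed

lemma prod_one_minus_eq_sum_Pow:
  fixes f :: "'b \<Rightarrow> 'c :: comm_ring_1"
  assumes "finite I"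
  shows "(\<Prod>i\<in>I. 1 - f i) = (\<Sum>A\<in>Pow I. (- 1) ^ card A * prod f A)"
  using prod_diff_conv_sum[OF assms, of "\<lambda>_. 1" f] by simp

text \<open>Makes \<open>qset q A\<close> an admissible geometric parameter. For positivity, one
  factor of the product is split off: it is below 1 and the others are at most 1.\<close>

lemma qset_bounds:
  assumes "finite A" "A \<noteq> {}" "\<And>j. j \<in> A \<Longrightarrow> 0 < q j \<and> q j < 1"
  shows "0 < qset q A" "qset q A < 1"
proof -
  show "qset q A < 1"
    unfolding qset_def using assms by (simp add: prod_pos)
  obtain a where a: "a \<in> A"
    using assms by auto
  have "(\<Prod>j\<in>A. 1 - q j) = (1 - q a) * (\<Prod>j\<in>A - {a}. 1 - q j)"
    using assms a by (simp add: prod.remove)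
  also have "\<dots> \<le> (1 - q a) * 1"
    using assms a by (intro mult_left_mono prod_le_1) (auto simp: less_imp_le)
  also have "\<dots> < 1"
    using assms a by auto
  finally show "0 < qset q A"
    by (simp add: qset_def)
qed

context
  fixes M :: "'a measure" and X :: "nat \<Rightarrow> 'a \<Rightarrow> nat"
    and q :: "nat \<Rightarrow> real" and I :: "nat set"
  assumes prob_space_M: "prob_space M"
    and I: "finite I" "I \<noteq> {}"
    and q: "\<And>j. j \<in> I \<Longrightarrow> 0 < q j \<and> q j < 1"
    and indep: "prob_space.indep_vars M (\<lambda>_. count_space UNIV) X I"
    and distr: "\<And>j. j \<in> I \<Longrightarrow> distr M (count_space UNIV) (X j) = measure_pmf (geo_pmf (q j))"
begin

interpretation prob_space M
  by (rule prob_space_M)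

lemma measurable_X: "j \<in> I \<Longrightarrow> X j \<in> measurable M (count_space UNIV)"
  using indep by (auto simp: indep_vars_def)

lemma measurable_Max_X: "(\<lambda>\<omega>. Max ((\<lambda>j. X j \<omega>) ` I)) \<in> measurable M (count_space UNIV)"
  using borel_measurable_Max[OF I(1), of X M] measurable_X
  by (simp add: measurable_cong_sets[OF refl sets_borel_eq_count_space])

lemma prob_Max_geo_le:
  "prob ((\<lambda>\<omega>. Max ((\<lambda>j. X j \<omega>) ` I)) -` {..k} \<inter> space M)
    = (\<Sum>A\<in>Pow I. (- 1) ^ card A * (1 - qset q A) ^ k)"
proof -
  have le: "Max ((\<lambda>j. X j \<omega>) ` I) \<le> k \<longleftrightarrow> (\<forall>j\<in>I. X j \<omega> \<le> k)" for \<omega>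
    using I by simp
  have "(\<lambda>\<omega>. Max ((\<lambda>j. X j \<omega>) ` I)) -` {..k} \<inter> space M = (\<Inter>j\<in>I. X j -` {..k} \<inter> space M)"
    using I(2) by (auto simp: le simp del: Max_le_iff)
  then have "prob ((\<lambda>\<omega>. Max ((\<lambda>j. X j \<omega>) ` I)) -` {..k} \<inter> space M)
      = (\<Prod>j\<in>I. prob (X j -` {..k} \<inter> space M))"
    using indep_varsD[OF indep I(2,1), of "\<lambda>_. {..k}"] by simp
  also have "\<dots> = (\<Prod>j\<in>I. 1 - (1 - q j) ^ k)"
  proof (rule prod.cong)
    fix j assume j: "j \<in> I"
    have "prob (X j -` {..k} \<inter> space M) = measure (distr M (count_space UNIV) (X j)) {..k}"
      using measurable_X[OF j] by (simp add: measure_distr)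
    then show "prob (X j -` {..k} \<inter> space M) = 1 - (1 - q j) ^ k"
      using q[OF j] by (simp add: distr[OF j] geo_pmf_atMost)
  qed simp
  also have "\<dots> = (\<Sum>A\<in>Pow I. (- 1) ^ card A * (1 - qset q A) ^ k)"
    \<comment> \<open>The product of \<open>(1 - q j) ^ k\<close> over \<open>A\<close> is
      \<open>(1 - qset q A) ^ k\<close>.\<close>
    using I by (simp add: prod_one_minus_eq_sum_Pow qset_def prod_power_distrib)
  finally show ?thesis .
qed

lemma prob_Max_geo_eq:
  "prob ((\<lambda>\<omega>. Max ((\<lambda>j. X j \<omega>) ` I)) -` {Suc k} \<inter> space M)
    = (\<Sum>A\<in>Pow I - {{}}. (- 1) ^ (card A + 1) * ((1 - qset q A) ^ k * qset q A))"
proof -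
  let ?Y = "\<lambda>\<omega>. Max ((\<lambda>j. X j \<omega>) ` I)"
  have "?Y -` {Suc k} \<inter> space M = (?Y -` {..Suc k} \<inter> space M) - (?Y -` {..k} \<inter> space M)"
    by auto
  also have "prob \<dots> = prob (?Y -` {..Suc k} \<inter> space M) - prob (?Y -` {..k} \<inter> space M)"
    by (intro finite_measure_Diff measurable_sets[OF measurable_Max_X]) auto
  \<comment> \<open>With \<open>x = 1 - qset q A\<close>, each difference is
    \<open>x ^ Suc k - x ^ k = - (x ^ k * qset q A)\<close>, which accounts for the extra
    sign.\<close>
  also have "\<dots> = (\<Sum>A\<in>Pow I. (- 1) ^ (card A + 1) * ((1 - qset q A) ^ k * qset q A))"
    unfolding prob_Max_geo_le by (simp add: algebra_simps flip: sum_subtractf)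
  \<comment> \<open>The empty set contributes 0 because \<open>qset q {} = 0\<close>.\<close>
  also have "\<dots> = (\<Sum>A\<in>Pow I - {{}}. (- 1) ^ (card A + 1) * ((1 - qset q A) ^ k * qset q A))"
    using I by (intro sum.mono_neutral_right) (auto simp: qset_def)
  finally show ?thesis .
qed

lemma has_bochner_integral_Max_geo_power:
  assumes r: "1 \<le> r"
  shows "has_bochner_integral M (\<lambda>\<omega>. real (Max ((\<lambda>j. X j \<omega>) ` I)) ^ r)
    (\<Sum>A\<in>Pow I - {{}}. (- 1) ^ (card A + 1) *
      (1 / qset q A *
        (\<Sum>l=1..r. real (Stirling r l) * (1 / qset q A - 1) ^ (l - 1) * fact l)))"
    (is "has_bochner_integral M _ ?S")
proof -
  let ?Y = "\<lambda>\<omega>. Max ((\<lambda>j. X j \<omega>) ` I)"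
  have "(\<lambda>k. \<Sum>A\<in>Pow I - {{}}. (- 1) ^ (card A + 1) *
      (real (Suc k) ^ r * ((1 - qset q A) ^ k * qset q A))) sums ?S"
    using I q r
    by (intro sums_sum sums_mult geometric_moment_sums qset_bounds)
      (auto intro: finite_subset)
  then have "(\<lambda>k. real (Suc k) ^ r * prob (?Y -` {Suc k} \<inter> space M)) sums ?S"
    unfolding prob_Max_geo_eq sum_distrib_left by (simp only: mult_ac)
  \<comment> \<open>Reindexing adds the term at 0, which is 0 because \<open>0 ^ r = 0\<close> for
    positive \<open>r\<close>.\<close>
  then have "(\<lambda>k. real k ^ r * prob (?Y -` {k} \<inter> space M)) sums ?S"
    using r by (subst (asm) sums_Suc_iff) (simp add: power_0_left)
  then show ?thesis
    by (intro has_bochner_integral_nat_valued[where f = "\<lambda>k. real k ^ r"] measurable_Max_X) auto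
qed

end

theorem proposition5:
  fixes M :: "'a measure" and X :: "nat \<Rightarrow> 'a \<Rightarrow> nat"
    and q :: "nat \<Rightarrow> real" and n r :: nat
  assumes "prob_space M"
    and "1 \<le> n" and "1 \<le> r"
    and "\<And>j. j \<in> {1..n} \<Longrightarrow> 0 < q j \<and> q j < 1"
    and "prob_space.indep_vars M (\<lambda>_. count_space UNIV) X {1..n}"
    and "\<And>j. j \<in> {1..n} \<Longrightarrow> distr M (count_space UNIV) (X j) = measure_pmf (geo_pmf (q j))"
  shows "integrable M (\<lambda>\<omega>. real (Max ((\<lambda>j. X j \<omega>) ` {1..n})) ^ r)
    \<and> prob_space.expectation M (\<lambda>\<omega>. real (Max ((\<lambda>j. X j \<omega>) ` {1..n})) ^ r) =
      (\<Sum>s=1..n. (- 1) ^ (s + 1) *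
        (\<Sum>A | A \<subseteq> {1..n} \<and> card A = s.
          1 / qset q A *
            (\<Sum>l=1..r. real (Stirling r l) * (1 / qset q A - 1) ^ (l - 1) * fact l)))"
proof -
  define c where "c A = 1 / qset q A *
    (\<Sum>l=1..r. real (Stirling r l) * (1 / qset q A - 1) ^ (l - 1) * fact l)" for A
  let ?P = "Pow {1..n} - {{}}"
  have "has_bochner_integral M (\<lambda>\<omega>. real (Max ((\<lambda>j. X j \<omega>) ` {1..n})) ^ r)
      (\<Sum>A\<in>?P. (- 1) ^ (card A + 1) * c A)"
    unfolding c_def using assms by (intro has_bochner_integral_Max_geo_power) auto
  moreover have "(\<Sum>A\<in>?P. (- 1) ^ (card A + 1) * c A)
      = (\<Sum>s=1..n. (- 1) ^ (s + 1) * (\<Sum>A | A \<subseteq> {1..n} \<and> card A = s. c A))"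
  proof -
    have "card ` ?P \<subseteq> {1..n}"
    proof (intro image_subsetI)
      fix A assume "A \<in> ?P"
      then have "finite A" "A \<noteq> {}" "A \<subseteq> {1..n}"
        by (auto intro: finite_subset)
      then show "card A \<in> {1..n}"
        using card_mono[of "{1..n}" A] by (auto simp: Suc_le_eq card_gt_0_iff)
    qed
    \<comment> \<open>Group the nonempty subsets by cardinality. Since \<open>s\<close> is at least
      1, the condition \<open>card A = s\<close> already excludes the empty set, which gives the
      index sets of the theorem.\<close>
    then have "(\<Sum>A\<in>?P. (- 1) ^ (card A + 1) * c A)
        = (\<Sum>s=1..n. \<Sum>A\<in>{A \<in> ?P. card A = s}. (- 1) ^ (card A + 1) * c A)"
      by (intro sum.group[symmetric]) auto
    also have "\<dots> = (\<Sum>s=1..n. (- 1) ^ (s + 1) * (\<Sum>A | A \<subseteq> {1..n} \<and> card A = s. c A))"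
      unfolding sum_distrib_left by (intro sum.cong) auto
    finally show ?thesis .
  qed
  ultimately show ?thesis
    by (simp add: has_bochner_integral_iff c_def)
qed

end
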